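(* Let $X$ be a sequentially complete Hausdorff locally convex space and $(T(t))_{t\geq 0}$ a strongly continuous locally equicontinuous semigroup on $X$ with generator $(A,D(A))$. Then \[ \sigma_{\mathrm{p}}(T(t))\setminus\{0\}=\mathrm{e}^{t\sigma_{\mathrm{p}}(A)} \] holds for all $t\geq 0$.
   Context: All locally convex spaces have scalar field $\mathbb{C}$. $\Gamma_X$ denotes a fundamental system of seminorms inducing the topology of $X$ (every continuous seminorm is bounded by a constant multiple of a member of $\Gamma_X$), and $\mathcal{L}(X)$ the space of continuous linear operators $X\to X$. A semigroup on $X$ is a family $(T(t))_{t\geq 0}$ in $\mathcal{L}(X)$ with $T(0)=\mathrm{id}$ and $T(t+s)=T(t)T(s)$ for all $t,s\geq 0$. It is strongly continuous if $t\mapsto T(t)x$ is continuous $[0,\infty)\to X$ for every $x\in X$. It is locally equicontinuous if for all $q\in\Gamma_X$ and $t_0\geq 0$ there are $p\in\Gamma_X$, $C\geq 0$ with $q(T(t)x)\leq Cp(x)$ for all $t\in[0,t_0]$, $x\in X$. The generator $(A,D(A))$ is given by $Ax=\lim_{t\to 0+}\frac{T(t)x-x}{t}$ with $D(A)$ the set of all $x\in X$ for which this limit exists in $X$. For a linear operator $(B,D(B))$ on $X$, the point spectrum is $\sigma_{\mathrm{p}}(B):=\{\lambda\in\mathbb{C}\mid\lambda-B\colon D(B)\to X\text{ is not injective}\}$. For $M\subseteq\mathbb{C}$, $\mathrm{e}^{tM}:=\{\mathrm{e}^{t\lambda}\mid\lambda\in M\}$.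
   Formalization: At t = 0 the claim fails when X ≠ {0} and σ_p(A) is empty (e.g. T(t)f = e^{tz}f on ℂ[[z]]: left side {1}, right side empty), so for t = 0 and X ≠ {0} the formal statement also assumes σ_p(A) is nonempty; for t > 0 nothing is changed. *)

theory Defs
  imports "HOL-Analysis.Analysis"
begin

definition seminorm :: "(complex \<Rightarrow> 'a::ab_group_add \<Rightarrow> 'a) \<Rightarrow> ('a \<Rightarrow> real) \<Rightarrow> bool" where
  "seminorm smul p \<longleftrightarrow>
     (\<forall>x y. p (x + y) \<le> p x + p y) \<and> (\<forall>c x. p (smul c x) = cmod c * p x)"

text \<open>The open balls of the seminorms are only taken as a subbase, so no directedness is
  needed for this to be the topology induced by \<open>P\<close>.\<close>

definition seminorm_topology :: "('a::ab_group_add \<Rightarrow> real) set \<Rightarrow> 'a topology" where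
  "seminorm_topology P = topology_generated_by {{y. p (y - x) < e} | p x e. p \<in> P \<and> e > 0}"

text \<open>A complex locally convex space whose carrier is the whole type \<open>'a\<close>, with topology \<open>X\<close>
  and a fundamental system \<open>\<Gamma>\<close> of seminorms inducing \<open>X\<close>. The Hausdorff property is not part of
  the definition. The last axiom, applied to the zero seminorm, forces \<open>\<Gamma>\<close> to be nonempty.\<close>

locale locally_convex_space = vector_space smul
  for smul :: "complex \<Rightarrow> 'a::ab_group_add \<Rightarrow> 'a" +
  fixes X :: "'a topology" and \<Gamma> :: "('a \<Rightarrow> real) set"
  assumes seminorms: "p \<in> \<Gamma> \<Longrightarrow> seminorm smul p"
    and topology_eq: "X = seminorm_topology \<Gamma>"
    and fundamental: "seminorm smul q \<Longrightarrow> continuous_map X euclideanreal q \<Longrightarrow>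
      \<exists>p\<in>\<Gamma>. \<exists>C\<ge>0. \<forall>x. q x \<le> C * p x"

definition Cauchy_sequence :: "'a::ab_group_add topology \<Rightarrow> (nat \<Rightarrow> 'a) \<Rightarrow> bool" where
  "Cauchy_sequence X s \<longleftrightarrow>
     (\<forall>U. openin X U \<and> 0 \<in> U \<longrightarrow> (\<exists>N. \<forall>m\<ge>N. \<forall>n\<ge>N. s m - s n \<in> U))"

definition sequentially_complete :: "'a::ab_group_add topology \<Rightarrow> bool" where
  "sequentially_complete X \<longleftrightarrow>
     (\<forall>s. Cauchy_sequence X s \<longrightarrow> (\<exists>l. limitin X s l sequentially))"

definition continuous_linear_operator ::
    "(complex \<Rightarrow> 'a::ab_group_add \<Rightarrow> 'a) \<Rightarrow> 'a topology \<Rightarrow> ('a \<Rightarrow> 'a) \<Rightarrow> bool" where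
  "continuous_linear_operator smul X f \<longleftrightarrow>
     Vector_Spaces.linear smul smul f \<and> continuous_map X X f"

text \<open>Semigroups are functions on all of \<open>real\<close>; only their values at \<open>t \<ge> 0\<close> are meaningful.\<close>

definition operator_semigroup ::
    "(complex \<Rightarrow> 'a::ab_group_add \<Rightarrow> 'a) \<Rightarrow> 'a topology \<Rightarrow> (real \<Rightarrow> 'a \<Rightarrow> 'a) \<Rightarrow> bool" where
  "operator_semigroup smul X T \<longleftrightarrow>
     (\<forall>t\<ge>0. continuous_linear_operator smul X (T t)) \<and>
     T 0 = id \<and>
     (\<forall>t\<ge>0. \<forall>s\<ge>0. T (t + s) = T t \<circ> T s)"

definition strongly_continuous :: "'a topology \<Rightarrow> (real \<Rightarrow> 'a \<Rightarrow> 'a) \<Rightarrow> bool" where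
  "strongly_continuous X T \<longleftrightarrow> (\<forall>x. continuous_map (top_of_set {0..}) X (\<lambda>t. T t x))"

definition locally_equicontinuous :: "('a \<Rightarrow> real) set \<Rightarrow> (real \<Rightarrow> 'a \<Rightarrow> 'a) \<Rightarrow> bool" where
  "locally_equicontinuous \<Gamma> T \<longleftrightarrow>
     (\<forall>q\<in>\<Gamma>. \<forall>t0\<ge>0. \<exists>p\<in>\<Gamma>. \<exists>C\<ge>0. \<forall>t\<in>{0..t0}. \<forall>x. q (T t x) \<le> C * p x)"

definition has_generator_value ::
    "(complex \<Rightarrow> 'a::ab_group_add \<Rightarrow> 'a) \<Rightarrow> 'a topology \<Rightarrow> (real \<Rightarrow> 'a \<Rightarrow> 'a) \<Rightarrow> 'a \<Rightarrow> 'a \<Rightarrow> bool" where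
  "has_generator_value smul X T x y \<longleftrightarrow>
     limitin X (\<lambda>t. smul (of_real (1 / t)) (T t x - x)) y (at_right 0)"

definition generator_domain ::
    "(complex \<Rightarrow> 'a::ab_group_add \<Rightarrow> 'a) \<Rightarrow> 'a topology \<Rightarrow> (real \<Rightarrow> 'a \<Rightarrow> 'a) \<Rightarrow> 'a set" where
  "generator_domain smul X T = {x. \<exists>y. has_generator_value smul X T x y}"

text \<open>Meaningful on the generator domain, for Hausdorff \<open>X\<close> (where limits are unique).\<close>

definition generator ::
    "(complex \<Rightarrow> 'a::ab_group_add \<Rightarrow> 'a) \<Rightarrow> 'a topology \<Rightarrow> (real \<Rightarrow> 'a \<Rightarrow> 'a) \<Rightarrow> 'a \<Rightarrow> 'a" where
  "generator smul X T x = (THE y. has_generator_value smul X T x y)"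

definition point_spectrum ::
    "(complex \<Rightarrow> 'a::ab_group_add \<Rightarrow> 'a) \<Rightarrow> ('a \<Rightarrow> 'a) \<Rightarrow> 'a set \<Rightarrow> complex set" where
  "point_spectrum smul B D = {z. \<not> inj_on (\<lambda>x. smul z x - B x) D}"

definition exp_set :: "real \<Rightarrow> complex set \<Rightarrow> complex set" where
  "exp_set t M = {exp (of_real t * z) | z. z \<in> M}"

end

theory Submission
  imports Defs
begin

text \<open>An eigenvector \<open>z\<close> of the generator with eigenvalue \<open>c\<close> satisfies \<open>T t z = e\<^sup>t\<^sup>c z\<close>: after
  multiplying the semigroup by \<open>e\<^sup>-\<^sup>t\<^sup>c\<close> the orbit of \<open>z\<close> has derivative zero at \<open>0\<close>, and a telescoping
  sum together with local equicontinuity turns this into constancy of the orbit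
  (\<open>invariant_if_derivative_zero\<close>, \<open>semigroup_eigenvector\<close>).

  Conversely, let \<open>T t x = w x\<close> with \<open>w \<noteq> 0\<close>, \<open>x \<noteq> 0\<close> and \<open>t > 0\<close>. Choose \<open>b\<close> with \<open>e\<^sup>t\<^sup>b = w\<close>; the
  rescaled orbit \<open>s \<mapsto> e\<^sup>-\<^sup>s\<^sup>b T s x\<close> is continuous and \<open>t\<close>-periodic. Its \<open>k\<close>-th Fourier coefficient is
  the mean over one period of the orbit rescaled once more by the frequency \<open>2 \<pi> \<i> k / t\<close>. Such a mean
  is a fixed point of the rescaled semigroup, so it is either zero or an eigenvector of the generator
  with eigenvalue \<open>b + 2 \<pi> \<i> k / t\<close>, whose exponential at time \<open>t\<close> is again \<open>w\<close>. It remains to see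
  that not all Fourier coefficients vanish, and this is Fejer's theorem: averaging the orbit against
  the Fejer kernel gives back \<open>x\<close> in the limit, while it is a finite combination of Fourier
  coefficients.

  No integral of vector-valued functions is involved. The means are limits of equidistant Riemann sums
  (\<open>orbit_mean\<close>), which form a Cauchy sequence because orbits are uniformly continuous on bounded
  intervals; this is where sequential completeness enters. At the level of the sums with \<open>N\<close>
  nodes, the Fejer argument is an exact computation with \<open>N\<close>-th roots of unity: the discrete mean of
  the kernel of order \<open>n < N\<close> is \<open>1\<close>, and its mean against \<open>1 - cos\<close> is \<open>1/n\<close>. As the displacement
  \<open>p (x - T s x)\<close> of a periodic orbit is at most \<open>e + M (1 - cos (2 \<pi> s / t))\<close>, the error is at most
  \<open>e + M/n\<close>, uniformly in \<open>N\<close> (\<open>fourier_means_separate\<close>).\<close>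

section \<open>Seminorms\<close>

lemma seminorm_triangle: "seminorm smul p \<Longrightarrow> p (x + y) \<le> p x + p y"
  by (simp add: seminorm_def)

lemma seminorm_scale: "seminorm smul p \<Longrightarrow> p (smul c x) = cmod c * p x"
  by (simp add: seminorm_def)

locale complex_vector_space = vector_space smul
  for smul :: "complex \<Rightarrow> 'a::ab_group_add \<Rightarrow> 'a"
begin

lemma seminorm_zero: "seminorm smul p \<Longrightarrow> p 0 = 0"
  using seminorm_scale[of smul p 0 0] by simp

lemma seminorm_minus: "seminorm smul p \<Longrightarrow> p (- x) = p x"
  using seminorm_scale[of smul p "-1" x] by simp

lemma seminorm_nonneg: "seminorm smul p \<Longrightarrow> 0 \<le> p x"
  using seminorm_triangle[of smul p x "- x"] by (simp add: seminorm_zero seminorm_minus)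

lemma seminorm_diff: "seminorm smul p \<Longrightarrow> p (x - y) \<le> p x + p y"
  using seminorm_triangle[of smul p x "- y"] by (simp add: seminorm_minus)

lemma seminorm_commute: "seminorm smul p \<Longrightarrow> p (x - y) = p (y - x)"
  using seminorm_minus[of p "x - y"] by simp

lemma seminorm_diff_triangle: "seminorm smul p \<Longrightarrow> p (x - z) \<le> p (x - y) + p (y - z)"
  using seminorm_triangle[of smul p "x - y" "y - z"] by simp

lemma seminorm_sum:
  assumes "seminorm smul p"
  shows "p (\<Sum>i\<in>I. f i) \<le> (\<Sum>i\<in>I. p (f i))"
proof (induction I rule: infinite_finite_induct)
  case (insert i I)
  then show ?case
    using seminorm_triangle[OF assms, of "f i" "\<Sum>i\<in>I. f i"] by simp
qed (simp_all add: seminorm_zero[OF assms])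

lemma seminorm_mean_le:
  assumes "seminorm smul p" "0 < N" "\<And>j. j < N \<Longrightarrow> p (f j) \<le> e"
  shows "p (smul (1 / of_nat N) (\<Sum>j<N. f j)) \<le> e"
proof -
  have "p (\<Sum>j<N. f j) \<le> (\<Sum>j<N. p (f j))"
    by (rule seminorm_sum[OF assms(1)])
  also have "\<dots> \<le> real N * e"
    using sum_bounded_above[of "{..<N}" "\<lambda>j. p (f j)" e] assms(3) by simp
  finally show ?thesis
    using \<open>0 < N\<close> by (simp add: seminorm_scale[OF assms(1)] norm_divide field_simps)
qed

end

section \<open>Semigroups described by seminorms\<close>

text \<open>A sum over a full period does not depend on the starting point.\<close>

lemma sum_periodic_shift:
  fixes g :: "nat \<Rightarrow> 'a::cancel_comm_monoid_add"
  assumes "\<And>j. g (j + N) = g j"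
  shows "(\<Sum>j<N. g (j + m)) = (\<Sum>j<N. g j)"
proof (induction m)
  case (Suc m)
  have "(\<Sum>j<N. g (j + Suc m)) + g m = (\<Sum>j<Suc N. g (j + m))"
    by (subst sum.lessThan_Suc_shift) (simp add: add.commute)
  also have "\<dots> = (\<Sum>j<N. g (j + m)) + g m"
    using assms[of m] by (simp add: add.commute)
  finally show ?case using Suc by simp
qed simp

text \<open>The left Riemann sum with \<open>N\<close> equidistant nodes of \<open>(1/t) \<integral>\<^sub>0\<^sup>t T s x ds\<close>. It takes the family \<open>T\<close> as
  an argument because it is applied to several rescalings of one semigroup.\<close>

definition orbit_mean ::
    "(complex \<Rightarrow> 'a::ab_group_add \<Rightarrow> 'a) \<Rightarrow> (real \<Rightarrow> 'a \<Rightarrow> 'a) \<Rightarrow> real \<Rightarrow> 'a \<Rightarrow> nat \<Rightarrow> 'a" where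
  "orbit_mean smul T t x N = smul (1 / of_nat N) (\<Sum>j<N. T (real j * t / real N) x)"

text \<open>All estimates below use only finitely many seminorms at a time, so they are carried out for a
  vector space with a family of seminorms. Continuity of orbits at \<open>0\<close> from the right is enough:
  equicontinuity propagates it to all times. These axioms, unlike their topological counterparts,
  are immediately seen to be stable under rescaling by an exponential.\<close>

locale seminormed_semigroup = complex_vector_space smul
  for smul :: "complex \<Rightarrow> 'a::ab_group_add \<Rightarrow> 'a" +
  fixes \<Gamma> :: "('a \<Rightarrow> real) set" and T :: "real \<Rightarrow> 'a \<Rightarrow> 'a"
  assumes seminorms: "p \<in> \<Gamma> \<Longrightarrow> seminorm smul p"
    and linear: "0 \<le> s \<Longrightarrow> Vector_Spaces.linear smul smul (T s)"
    and zero [simp]: "T 0 x = x"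
    and add: "0 \<le> r \<Longrightarrow> 0 \<le> s \<Longrightarrow> T (r + s) x = T r (T s x)"
    and orbit_tendsto: "p \<in> \<Gamma> \<Longrightarrow> ((\<lambda>s. p (T s x - x)) \<longlongrightarrow> 0) (at_right 0)"
    and equicontinuous: "p \<in> \<Gamma> \<Longrightarrow> 0 \<le> b \<Longrightarrow>
      \<exists>q\<in>\<Gamma>. \<exists>C\<ge>0. \<forall>s\<in>{0..b}. \<forall>x. p (T s x) \<le> C * q x"
begin

lemma op_add: "0 \<le> s \<Longrightarrow> T s (x + y) = T s x + T s y"
  using linear[of s] by (simp add: module_hom.add flip: module_hom_iff_linear)

lemma op_diff: "0 \<le> s \<Longrightarrow> T s (x - y) = T s x - T s y"
  using linear[of s] by (simp add: module_hom.diff flip: module_hom_iff_linear)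

lemma op_scale: "0 \<le> s \<Longrightarrow> T s (smul c x) = smul c (T s x)"
  using linear[of s] by (simp add: module_hom.scale flip: module_hom_iff_linear)

lemma op_sum: "0 \<le> s \<Longrightarrow> T s (\<Sum>i\<in>I. f i) = (\<Sum>i\<in>I. T s (f i))"
  using linear[of s] by (simp add: module_hom.sum flip: module_hom_iff_linear)

text \<open>The increment \<open>T s x - T r x\<close> with \<open>r \<le> s\<close> is \<open>T r\<close> applied to \<open>T (s - r) x - x\<close>, so equicontinuity
  bounds it by the behaviour of the orbit near \<open>0\<close> alone.\<close>

lemma orbit_uniformly_continuous:
  assumes p: "p \<in> \<Gamma>" and b: "0 \<le> b" and e: "0 < e"
  obtains d where "0 < d"
    "\<And>r s. r \<in> {0..b} \<Longrightarrow> s \<in> {0..b} \<Longrightarrow> \<bar>r - s\<bar> < d \<Longrightarrow> p (T r x - T s x) < e"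
proof -
  obtain q C where q: "q \<in> \<Gamma>" and C: "0 \<le> C" "\<And>s y. s \<in> {0..b} \<Longrightarrow> p (T s y) \<le> C * q y"
    using equicontinuous[OF p b] by metis
  have "((\<lambda>s. C * q (T s x - x)) \<longlongrightarrow> C * 0) (at_right 0)"
    by (intro tendsto_intros orbit_tendsto q)
  then have "eventually (\<lambda>s. C * q (T s x - x) < e) (at_right 0)"
    using e by (intro order_tendstoD(2)) auto
  then obtain d where d: "0 < d" "\<And>s. 0 < s \<Longrightarrow> s < d \<Longrightarrow> C * q (T s x - x) < e"
    by (auto simp: eventually_at_right_field)
  have *: "p (T s x - T r x) < e" if "r \<in> {0..b}" "r \<le> s" "s - r < d" for r s
  proof (cases "r = s")
    case True
    then show ?thesis using e seminorm_zero[OF seminorms[OF p]] by simp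
  next
    case False
    have "T s x - T r x = T r (T (s - r) x - x)"
      using add[of r "s - r" x] that by (simp add: op_diff)
    then have "p (T s x - T r x) \<le> C * q (T (s - r) x - x)"
      using C(2)[OF that(1)] by simp
    also have "\<dots> < e"
      using d(2)[of "s - r"] that False by simp
    finally show ?thesis .
  qed
  show thesis
  proof (rule that[OF d(1)])
    fix r s
    assume rs: "r \<in> {0..b}" "s \<in> {0..b}" "\<bar>r - s\<bar> < d"
    show "p (T r x - T s x) < e"
    proof (cases "r \<le> s")
      case True
      then have "p (T s x - T r x) < e" using rs by (intro *) auto
      then show ?thesis by (simp add: seminorm_commute[OF seminorms[OF p]])
    next
      case False
      then show ?thesis using rs by (intro *) auto
    qed
  qed
qed

text \<open>Cut \<open>[0, t]\<close> into \<open>n\<close> steps of length \<open>h = t/n\<close>. The displacement \<open>T t z - z\<close> telescopes into \<open>n\<close>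
  images of \<open>T h z - z\<close> under uniformly bounded operators, each of size \<open>o(1/n)\<close>.\<close>

lemma invariant_if_derivative_zero:
  assumes z: "\<And>q. q \<in> \<Gamma> \<Longrightarrow> ((\<lambda>h. q (T h z - z) / h) \<longlongrightarrow> 0) (at_right 0)"
    and p: "p \<in> \<Gamma>" and t: "0 < t"
  shows "p (T t z - z) = 0"
proof -
  obtain q C where q: "q \<in> \<Gamma>" and C: "0 \<le> C" "\<And>s y. s \<in> {0..t} \<Longrightarrow> p (T s y) \<le> C * q y"
    using equicontinuous[OF p less_imp_le[OF t]] by metis
  have bound: "p (T t z - z) \<le> C * t * (q (T (t / n) z - z) / (t / n))" if n: "0 < n" for n :: nat
  proof -
    define h where "h = t / n"
    have h: "0 < h" "n * h = t" using t n by (simp_all add: h_def)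
    have step: "T (Suc k * h) z - T (k * h) z = T (k * h) (T h z - z)" for k :: nat
    proof -
      have "T (k * h + h) z = T (k * h) (T h z)"
        using h by (intro add) auto
      then show ?thesis
        using h by (simp add: op_diff algebra_simps)
    qed
    have "T t z - z = (\<Sum>k<n. T (Suc k * h) z - T (k * h) z)"
      using h sum_lessThan_telescope[of "\<lambda>k. T (real k * h) z" n] by simp
    also have "\<dots> = (\<Sum>k<n. T (k * h) (T h z - z))"
      by (simp only: step)
    finally have "p (T t z - z) \<le> (\<Sum>k<n. p (T (k * h) (T h z - z)))"
      by (simp add: seminorm_sum[OF seminorms[OF p]])
    also have "\<dots> \<le> (\<Sum>k<n. C * q (T h z - z))"
    proof (intro sum_mono C(2))
      fix k assume "k \<in> {..<n}"
      then have "k * h \<le> n * h" using h by (intro mult_right_mono) auto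
      then show "k * h \<in> {0..t}" using h by simp
    qed
    also have "\<dots> = C * t * (q (T h z - z) / h)"
      using h by (simp flip: h(2))
    finally show ?thesis by (simp add: h_def)
  qed
  have "filterlim (\<lambda>n::nat. t / n) (at_right 0) sequentially"
  proof (rule filterlim_at_withinI)
    show "(\<lambda>n::nat. t / n) \<longlonglongrightarrow> 0" by (rule lim_const_over_n)
    show "eventually (\<lambda>n::nat. t / n \<in> {0<..} - {0}) sequentially"
      using t by (intro eventually_mono[OF eventually_gt_at_top[of 0]]) auto
  qed
  then have "(\<lambda>n::nat. q (T (t / n) z - z) / (t / n)) \<longlonglongrightarrow> 0"
    by (rule filterlim_compose[OF z[OF q]])
  then have "(\<lambda>n::nat. C * t * (q (T (t / n) z - z) / (t / n))) \<longlonglongrightarrow> C * t * 0"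
    by (rule tendsto_mult_left)
  moreover have "eventually (\<lambda>n::nat. p (T t z - z) \<le> C * t * (q (T (t / n) z - z) / (t / n)))
      sequentially"
    by (rule eventually_mono[OF eventually_gt_at_top[of 0]]) (rule bound)
  ultimately have "p (T t z - z) \<le> C * t * 0"
    by (rule tendsto_lowerbound) simp
  then show ?thesis
    using seminorm_nonneg[OF seminorms[OF p], of "T t z - z"] by simp
qed

text \<open>Each node is repeated \<open>M\<close> times, which puts the sum with \<open>N\<close> nodes on the grid with \<open>N M\<close> nodes.\<close>

lemma orbit_mean_blocks:
  assumes "0 < M"
  shows "orbit_mean smul T t x N = smul (1 / of_nat (N * M)) (\<Sum>i<N*M. T (real (i div M) * t / N) x)"
proof -
  have "(\<Sum>i<N*M. T (real (i div M) * t / N) x)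
      = (\<Sum>j<N. \<Sum>i\<in>{j*M..<j*M+M}. T (real (i div M) * t / N) x)"
    by (simp add: sum.nat_group)
  also have "\<dots> = (\<Sum>j<N. \<Sum>i\<in>{j*M..<j*M+M}. T (j * t / N) x)"
  proof (intro sum.cong refl)
    fix j i
    assume "i \<in> {j*M..<j*M+M}"
    then have "i div M = j"
      by (intro div_nat_eqI) (auto simp: algebra_simps)
    then show "T (real (i div M) * t / N) x = T (j * t / N) x" by simp
  qed
  also have "\<dots> = smul (of_nat M) (\<Sum>j<N. T (j * t / N) x)"
    by (simp add: sum_constant_scale scale_sum_right)
  finally show ?thesis
    using assms by (simp add: orbit_mean_def)
qed

text \<open>A sum and any refinement of it differ by at most the oscillation of the orbit on one step; two sums
  are compared through their common refinement with \<open>M N\<close> nodes.\<close>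

lemma orbit_mean_Cauchy:
  assumes p: "p \<in> \<Gamma>" and t: "0 < t" and e: "0 < e"
  shows "\<exists>N0. \<forall>M\<ge>N0. \<forall>N\<ge>N0. p (orbit_mean smul T t x M - orbit_mean smul T t x N) < e"
proof -
  note sp = seminorms[OF p]
  obtain d where d: "0 < d"
    "\<And>r s. r \<in> {0..t} \<Longrightarrow> s \<in> {0..t} \<Longrightarrow> \<bar>r - s\<bar> < d \<Longrightarrow> p (T r x - T s x) < e / 3"
    using orbit_uniformly_continuous[OF p, of t "e / 3" x] t e by auto
  obtain N0 :: nat where N0: "t / d < N0" using reals_Archimedean2 by blast
  have refine: "p (orbit_mean smul T t x (N * M) - orbit_mean smul T t x N) \<le> e / 3"
    if N: "N0 \<le> N" and M: "0 < M" for N M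
  proof -
    have "0 < t / d" using t d by simp
    moreover have tdN: "t / d < N" using N0 N by (meson less_le_trans of_nat_le_iff)
    ultimately have Npos: "0 < N" by (metis less_asym neq0_conv of_nat_0)
    have tN: "t / N < d" using tdN Npos d by (simp add: field_simps)
    have "orbit_mean smul T t x (N * M) - orbit_mean smul T t x N
        = smul (1 / of_nat (N * M))
          (\<Sum>i<N*M. T (i * t / (N * M)) x - T (real (i div M) * t / N) x)"
      by (simp only: orbit_mean_blocks[OF M, of t x N] orbit_mean_def[of smul T t x "N * M"]
          scale_right_diff_distrib sum_subtractf of_nat_mult)
    moreover have "p (T (i * t / (N * M)) x - T (real (i div M) * t / N) x) \<le> e / 3"
      if i: "i < N * M" for i
    proof -
      have split: "real i = real (i div M) * M + real (i mod M)"
        by (metis div_mult_mod_eq of_nat_add of_nat_mult)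
      have "i div M < N" using i M by (simp add: less_mult_imp_div_less)
      then have "real (i div M) * t / N \<in> {0..t}"
        using t Npos by (simp add: field_simps)
      moreover have "i * t / (N * M) \<in> {0..t}"
      proof -
        have "real i \<le> real N * real M"
          using i by (metis less_imp_le of_nat_le_iff of_nat_mult)
        then show ?thesis
          using t Npos M by (simp add: field_simps)
      qed
      moreover have "i * t / (N * M) - real (i div M) * t / N = (real (i mod M) / M) * (t / N)"
        unfolding split using Npos M by (simp add: field_simps)
      moreover have "real (i mod M) / M * (t / N) \<le> 1 * (t / N)"
        using M t by (intro mult_right_mono) (auto simp: less_imp_le)
      moreover have "0 \<le> real (i mod M) / M * (t / N)"
        using t by simp
      ultimately show ?thesis
        using tN d(2)[of "i * t / (N * M)" "real (i div M) * t / N"] by fastforce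
    qed
    ultimately show ?thesis
      using Npos M by (simp only: seminorm_mean_le[OF sp, of "N * M"] mult_pos_pos)
  qed
  show ?thesis
  proof (intro exI[of _ "Suc N0"] allI impI)
    fix M N assume MN: "Suc N0 \<le> M" "Suc N0 \<le> N"
    have "p (orbit_mean smul T t x M - orbit_mean smul T t x N)
        \<le> p (orbit_mean smul T t x M - orbit_mean smul T t x (M * N))
          + p (orbit_mean smul T t x (N * M) - orbit_mean smul T t x N)"
      using seminorm_diff_triangle[OF sp] by (simp add: mult.commute)
    also have "\<dots> \<le> e / 3 + e / 3"
      using refine[of M N] refine[of N M] MN
      by (intro add_mono) (auto simp: seminorm_commute[OF sp, of "orbit_mean smul T t x M"])
    finally show "p (orbit_mean smul T t x M - orbit_mean smul T t x N) < e" using e by simp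
  qed
qed

lemma orbit_periodic:
  assumes "T t x = x" "0 \<le> t" "0 \<le> s"
  shows "T (s + t) x = T s x"
  using add[of s t x] assms by simp

text \<open>Applying \<open>T h\<close> shifts all nodes by \<open>h\<close>. A shift by a multiple of the step \<open>t/N\<close> permutes the nodes
  of a periodic orbit, and \<open>h\<close> is within one step of such a multiple.\<close>

lemma orbit_mean_asymptotically_invariant:
  assumes p: "p \<in> \<Gamma>" and t: "0 < t" and x: "T t x = x" and h: "0 \<le> h"
  shows "(\<lambda>N. p (T h (orbit_mean smul T t x N) - orbit_mean smul T t x N)) \<longlonglongrightarrow> 0"
proof (rule LIMSEQ_I)
  fix e :: real
  assume e: "0 < e"
  note sp = seminorms[OF p]
  obtain d where d: "0 < d"
    "\<And>r s. r \<in> {0..h + t} \<Longrightarrow> s \<in> {0..h + t} \<Longrightarrow> \<bar>r - s\<bar> < d \<Longrightarrow> p (T r x - T s x) < e / 2"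
    using orbit_uniformly_continuous[OF p, of "h + t" "e / 2" x] t h e by auto
  obtain N0 :: nat where N0: "t / d < N0" using reals_Archimedean2 by blast
  have "p (T h (orbit_mean smul T t x N) - orbit_mean smul T t x N) \<le> e / 2" if N: "N0 \<le> N" for N
  proof -
    have "0 < t / d" using t d by simp
    moreover have tdN: "t / d < N" using N0 N by (meson less_le_trans of_nat_le_iff)
    ultimately have Npos: "0 < N" by (metis less_asym neq0_conv of_nat_0)
    have tN: "t / N < d" using tdN Npos d by (simp add: field_simps)
    \<comment> \<open>the largest number of whole steps \<open>t/N\<close> that fit into \<open>h\<close>\<close>
    define m where "m = nat \<lfloor>h * N / t\<rfloor>"
    have "0 \<le> h * N / t" using h t by simp
    then have m: "m \<le> h * N / t" "h * N / t < m + 1"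
      unfolding m_def by (simp_all add: of_nat_nat) linarith+
    have m': "m * t / N \<le> h" "h - m * t / N < d"
    proof -
      show "m * t / N \<le> h" using m(1) t Npos by (simp add: field_simps)
      have "h < (m + 1) * t / N" using m(2) t Npos by (simp add: field_simps)
      then have "h - m * t / N < t / N" by (simp add: add_divide_distrib distrib_right)
      then show "h - m * t / N < d" using tN by simp
    qed
    have "T ((j + N) * t / N) x = T (j * t / N) x" for j :: nat
      using orbit_periodic[OF x, of "j * t / N"] t Npos by (simp add: field_simps)
    then have "(\<Sum>j<N. T (j * t / N) x) = (\<Sum>j<N. T ((j + m) * t / N) x)"
      using sum_periodic_shift[of "\<lambda>j. T (real j * t / N) x" N m] by simp
    moreover have "T h (orbit_mean smul T t x N) = smul (1 / of_nat N) (\<Sum>j<N. T (h + j * t / N) x)"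
      using h t by (simp add: orbit_mean_def op_scale op_sum add)
    ultimately have "T h (orbit_mean smul T t x N) - orbit_mean smul T t x N
        = smul (1 / of_nat N) (\<Sum>j<N. T (h + j * t / N) x - T ((j + m) * t / N) x)"
      by (simp only: orbit_mean_def scale_right_diff_distrib sum_subtractf)
    moreover have "p (T (h + j * t / N) x - T ((j + m) * t / N) x) \<le> e / 2" if j: "j < N" for j
    proof -
      have "j * t / N \<le> t" "0 \<le> j * t / N" "0 \<le> m * t / N"
        using t j Npos by (simp_all add: field_simps)
      moreover have "(j + m) * t / N = j * t / N + m * t / N"
        by (simp add: add_divide_distrib distrib_right)
      ultimately show ?thesis
        using m' h by (intro less_imp_le d(2)) auto
    qed
    ultimately show ?thesis
      by (simp only: seminorm_mean_le[OF sp Npos])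
  qed
  then show "\<exists>N0. \<forall>N\<ge>N0. norm (p (T h (orbit_mean smul T t x N) - orbit_mean smul T t x N) - 0) < e"
    using e seminorm_nonneg[OF sp] by (intro exI[of _ N0]) fastforce
qed

lemma orbit_mean_limit_invariant:
  assumes t: "0 < t" and x: "T t x = x" and h: "0 \<le> h"
    and y: "\<And>q. q \<in> \<Gamma> \<Longrightarrow> (\<lambda>N. q (orbit_mean smul T t x N - y)) \<longlonglongrightarrow> 0" and p: "p \<in> \<Gamma>"
  shows "p (T h y - y) = 0"
proof -
  note sp = seminorms[OF p]
  obtain q C where q: "q \<in> \<Gamma>" and C: "0 \<le> C" "\<And>s z. s \<in> {0..h} \<Longrightarrow> p (T s z) \<le> C * q z"
    using equicontinuous[OF p h] by metis
  let ?R = "orbit_mean smul T t x"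
  have bound: "p (T h y - y) \<le> C * q (?R N - y) + p (T h (?R N) - ?R N) + p (?R N - y)" for N
  proof -
    have "p (T h y - T h (?R N)) \<le> C * q (?R N - y)"
      using C(2)[of h "?R N - y"] h
      by (simp add: op_diff seminorm_commute[OF sp, of "T h y"])
    then show ?thesis
      using seminorm_diff_triangle[OF sp, of "T h y" y "T h (?R N)"]
        seminorm_diff_triangle[OF sp, of "T h (?R N)" y "?R N"] by linarith
  qed
  have "(\<lambda>N. C * q (?R N - y) + p (T h (?R N) - ?R N) + p (?R N - y)) \<longlonglongrightarrow> C * 0 + 0 + 0"
    by (intro tendsto_intros y p q orbit_mean_asymptotically_invariant t x h)
  then have "p (T h y - y) \<le> C * 0 + 0 + 0"
    by (rule tendsto_lowerbound) (simp_all add: bound)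
  then show ?thesis using seminorm_nonneg[OF sp, of "T h y - y"] by simp
qed

end

section \<open>Rescaling\<close>

definition rescale ::
    "(complex \<Rightarrow> 'a \<Rightarrow> 'a) \<Rightarrow> complex \<Rightarrow> (real \<Rightarrow> 'a \<Rightarrow> 'a) \<Rightarrow> real \<Rightarrow> 'a \<Rightarrow> 'a" where
  "rescale smul c T = (\<lambda>s x. smul (exp (- (of_real s * c))) (T s x))"

text \<open>Rescaling by \<open>c\<close> translates the spectrum of the generator by \<open>- c\<close>, so that every eigenvalue can be
  moved to \<open>0\<close>, where eigenvectors become fixed points.\<close>

lemma (in seminormed_semigroup) seminormed_semigroup_rescale:
  "seminormed_semigroup smul \<Gamma> (rescale smul c T)"
proof (intro seminormed_semigroup.intro seminormed_semigroup_axioms.intro)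
  show "complex_vector_space smul" by unfold_locales
  show "rescale smul c T 0 x = x" for x by (simp add: rescale_def)
  show "Vector_Spaces.linear smul smul (rescale smul c T s)" if "0 \<le> s" for s
    using that unfolding Vector_Spaces.linear_iff
    by (simp add: vector_space_axioms rescale_def op_add op_scale scale_right_distrib mult.commute)
  show "rescale smul c T (r + s) x = rescale smul c T r (rescale smul c T s x)"
    if "0 \<le> r" "0 \<le> s" for r s x
    using that by (simp add: rescale_def add op_scale mult_exp_exp algebra_simps)
  fix p assume p: "p \<in> \<Gamma>"
  note sp = seminorms[OF p]
  then show "seminorm smul p" .
  show "((\<lambda>s. p (rescale smul c T s x - x)) \<longlongrightarrow> 0) (at_right 0)" for x
  proof (rule tendsto_sandwich)
    let ?a = "\<lambda>s. exp (- (complex_of_real s * c))"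
    show "\<forall>\<^sub>F s in at_right 0. 0 \<le> p (rescale smul c T s x - x)"
      using seminorm_nonneg[OF sp] by simp
    have "p (rescale smul c T s x - x) \<le> cmod (?a s) * p (T s x - x) + cmod (?a s - 1) * p x" for s
    proof -
      have "rescale smul c T s x - x = smul (?a s) (T s x - x) + smul (?a s - 1) x"
        by (simp add: rescale_def scale_right_diff_distrib scale_left_diff_distrib)
      then show ?thesis
        by (metis seminorm_triangle[OF sp] seminorm_scale[OF sp])
    qed
    then show "\<forall>\<^sub>F s in at_right 0. p (rescale smul c T s x - x)
        \<le> cmod (?a s) * p (T s x - x) + cmod (?a s - 1) * p x"
      by simp
    have "((\<lambda>s. cmod (?a s) * p (T s x - x) + cmod (?a s - 1) * p x) \<longlongrightarrow>
        cmod (?a 0) * 0 + cmod (?a 0 - 1) * p x) (at_right 0)"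
      by (intro tendsto_intros orbit_tendsto p)
    then show "((\<lambda>s. cmod (?a s) * p (T s x - x) + cmod (?a s - 1) * p x) \<longlongrightarrow> 0) (at_right 0)"
      by simp
  qed simp
  show "\<exists>q\<in>\<Gamma>. \<exists>C\<ge>0. \<forall>s\<in>{0..b}. \<forall>x. p (rescale smul c T s x) \<le> C * q x" if b: "0 \<le> b" for b
  proof -
    obtain q C where q: "q \<in> \<Gamma>" and C: "0 \<le> C" "\<And>s x. s \<in> {0..b} \<Longrightarrow> p (T s x) \<le> C * q x"
      using equicontinuous[OF p b] by metis
    have "p (rescale smul c T s x) \<le> (exp (b * cmod c) * C) * q x" if s: "s \<in> {0..b}" for s x
    proof -
      have "cmod (exp (- (of_real s * c))) \<le> exp (cmod (- (of_real s * c)))"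
        by (rule norm_exp)
      also have "\<dots> \<le> exp (b * cmod c)"
        using s by (auto simp: norm_mult intro: mult_right_mono)
      finally have "cmod (exp (- (of_real s * c))) * p (T s x) \<le> exp (b * cmod c) * (C * q x)"
        using C(2)[OF s] seminorm_nonneg[OF sp] by (intro mult_mono) auto
      then show ?thesis by (simp add: rescale_def seminorm_scale[OF sp] mult.assoc)
    qed
    then show ?thesis
      using q C(1) by (intro bexI[of _ q] exI[of _ "exp (b * cmod c) * C"]) auto
  qed
qed

section \<open>The Fejer kernel on roots of unity\<close>

definition fejer :: "nat \<Rightarrow> real \<Rightarrow> real" where
  "fejer n \<theta> = (cmod (\<Sum>a<n. cis (real a * \<theta>)))\<^sup>2 / real n"

lemma fejer_nonneg: "0 \<le> fejer n \<theta>"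
  by (simp add: fejer_def)

text \<open>In this form the kernel is visibly a trigonometric polynomial of degree less than \<open>n\<close>.\<close>

lemma fejer_expand:
  "complex_of_real (fejer n \<theta>)
    = (\<Sum>a<n. \<Sum>b<n. cis (of_int (int a - int b) * \<theta>)) / of_nat n"
proof -
  have "complex_of_real ((cmod (\<Sum>a<n. cis (a * \<theta>)))\<^sup>2)
      = (\<Sum>a<n. cis (a * \<theta>)) * (\<Sum>b<n. cis (- (b * \<theta>)))"
    by (simp only: complex_norm_square cnj_sum cis_cnj)
  also have "\<dots> = (\<Sum>a<n. \<Sum>b<n. cis (a * \<theta>) * cis (- (b * \<theta>)))"
    by (rule sum_product)
  also have "\<dots> = (\<Sum>a<n. \<Sum>b<n. cis (of_int (int a - int b) * \<theta>))"
    by (simp add: cis_mult left_diff_distrib)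
  finally show ?thesis by (simp add: fejer_def)
qed

text \<open>A geometric sum whose ratio is an \<open>N\<close>-th root of unity; it is degenerate exactly when the ratio is
  \<open>1\<close>.\<close>

lemma sum_roots_of_unity:
  assumes N: "0 < N"
  shows "(\<Sum>j<N. cis (of_int m * (2 * pi * real j / real N)))
    = (if int N dvd m then of_nat N else 0)"
proof -
  define z where "z = cis (of_int m * (2 * pi / real N))"
  have pow: "cis (of_int m * (2 * pi * real j / real N)) = z ^ j" for j
    by (simp add: z_def Complex.DeMoivre mult_ac)
  have zN: "z ^ N = 1"
    using N cis_multiple_2pi[of "of_int m"] by (simp add: z_def Complex.DeMoivre mult_ac)
  have z1: "z = 1 \<longleftrightarrow> int N dvd m"
  proof
    assume "int N dvd m"
    then obtain k where "m = int N * k" by (rule dvdE)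
    then show "z = 1"
      using N cis_multiple_2pi[of "of_int k"] by (simp add: z_def mult_ac)
  next
    assume "z = 1"
    then have "exp (\<i> * of_real (of_int m * (2 * pi / real N))) = 1"
      by (simp add: z_def cis_conv_exp)
    then obtain k :: int where "of_int m * (2 * pi / real N) = of_int (2 * k) * pi"
      unfolding exp_eq_1 by auto
    then have "real_of_int m = of_int (int N * k)"
      using N by (simp add: field_simps)
    then have "m = int N * k" by (simp only: of_int_eq_iff)
    then show "int N dvd m" by simp
  qed
  show ?thesis
  proof (cases "z = 1")
    case True
    then show ?thesis unfolding pow using z1 by simp
  next
    case False
    then have "(\<Sum>j<N. z ^ j) = 0"
      using one_diff_power_eq[of z N] zN by simp
    then show ?thesis unfolding pow using False z1 by simp
  qed
qed

text \<open>By orthogonality only the pairs \<open>(a, b)\<close> with \<open>a - b + m \<equiv> 0\<close> modulo \<open>N\<close> survive. Since \<open>n + m \<le> N\<close>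
  there is no aliasing, the congruence is the equation \<open>b = a + m\<close>, and it has \<open>n - m\<close> solutions.\<close>

lemma fejer_discrete_coefficient:
  assumes "0 < n" "n + m \<le> N"
  shows "(\<Sum>j<N. complex_of_real (fejer n (2 * pi * real j / real N))
      * cis (m * (2 * pi * real j / real N)))
    = of_nat N * of_nat (n - m) / of_nat n"
proof -
  let ?\<theta> = "\<lambda>j. 2 * pi * real j / real N"
  have N: "0 < N" using assms by simp
  have shift: "complex_of_real (fejer n \<theta>) * cis (real m * \<theta>)
      = (\<Sum>a<n. \<Sum>b<n. cis (of_int (int a - int b + int m) * \<theta>)) / of_nat n" for \<theta>
    by (simp add: fejer_expand sum_distrib_right sum_distrib_left cis_mult algebra_simps)
  have "(\<Sum>j<N. complex_of_real (fejer n (?\<theta> j)) * cis (m * ?\<theta> j))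
      = (\<Sum>j<N. \<Sum>a<n. \<Sum>b<n. cis (of_int (int a - int b + int m) * ?\<theta> j)) / of_nat n"
    by (simp only: shift sum_divide_distrib)
  also have "(\<Sum>j<N. \<Sum>a<n. \<Sum>b<n. cis (of_int (int a - int b + int m) * ?\<theta> j))
      = (\<Sum>a<n. \<Sum>b<n. \<Sum>j<N. cis (of_int (int a - int b + int m) * ?\<theta> j))"
    by (subst sum.swap, rule sum.cong[OF refl], rule sum.swap)
  also have "\<dots> = (\<Sum>a<n. \<Sum>b<n. if b = a + m then of_nat N else 0)"
  proof (intro sum.cong refl)
    fix a b assume "a \<in> {..<n}" "b \<in> {..<n}"
    then have "\<bar>int a - int b + int m\<bar> < int N"
      using assms by auto
    then have "int N dvd int a - int b + int m \<longleftrightarrow> b = a + m"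
      using dvd_imp_le_int[of "int a - int b + int m" "int N"] by fastforce
    then show "(\<Sum>j<N. cis (of_int (int a - int b + int m) * ?\<theta> j))
        = (if b = a + m then of_nat N else 0)"
      by (simp only: sum_roots_of_unity[OF N])
  qed
  also have "\<dots> = (\<Sum>a<n. if a < n - m then of_nat N else 0)"
    by (intro sum.cong refl) (auto simp: sum.delta)
  also have "\<dots> = of_nat N * of_nat (n - m)"
  proof -
    have "{..<n} \<inter> {a. a < n - m} = {..<n - m}" by auto
    then show ?thesis by (simp add: sum.If_cases mult.commute)
  qed
  finally show ?thesis .
qed

lemma fejer_mean:
  assumes "0 < n" "n \<le> N"
  shows "(\<Sum>j<N. fejer n (2 * pi * real j / real N)) = N"
proof -
  have "complex_of_real (\<Sum>j<N. fejer n (2 * pi * real j / real N)) = of_real N"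
    using fejer_discrete_coefficient[of n 0 N] assms by simp
  then show ?thesis by (simp only: of_real_eq_iff)
qed

lemma fejer_mean_cos:
  assumes "0 < n" "n < N"
  shows "(\<Sum>j<N. fejer n (2 * pi * real j / real N) * (1 - cos (2 * pi * real j / real N))) = N / n"
proof -
  have "(\<Sum>j<N. fejer n (2 * pi * real j / real N) * cos (2 * pi * real j / real N))
      = Re (\<Sum>j<N. complex_of_real (fejer n (2 * pi * real j / real N))
          * cis (1 * (2 * pi * real j / real N)))"
    by simp
  also have "\<dots> = Re (of_real (real N * real (n - 1) / real n))"
    using fejer_discrete_coefficient[of n 1 N] assms by simp
  also have "\<dots> = real N * (n - 1) / n"
    using assms by simp
  finally show ?thesis
    using assms fejer_mean[of n N] by (simp add: right_diff_distrib sum_subtractf field_simps)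
qed

section \<open>Completeness of the Fourier modes\<close>

context seminormed_semigroup
begin

text \<open>Near the two ends of the period the displacement is below \<open>e\<close>, because \<open>T 0 x = x = T t x\<close>. In
  between \<open>1 - cos\<close> is bounded away from zero, so a large multiple of it dominates the displacement,
  which is bounded. This reduces the convergence of Fejer means to the single test function \<open>cos\<close>, as
  in Korovkin's theorem.\<close>

lemma periodic_orbit_displacement_le:
  assumes p: "p \<in> \<Gamma>" and t: "0 < t" and x: "T t x = x" and e: "0 < e"
  obtains M where "\<And>s. s \<in> {0..t} \<Longrightarrow> p (x - T s x) \<le> e + M * (1 - cos (2 * pi * s / t))"
proof -
  note sp = seminorms[OF p]
  obtain q C where q: "q \<in> \<Gamma>" and C: "0 \<le> C" "\<And>s y. s \<in> {0..t} \<Longrightarrow> p (T s y) \<le> C * q y"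
    using equicontinuous[OF p less_imp_le[OF t]] by metis
  define B where "B = p x + C * q x"
  have B: "p (x - T s x) \<le> B" if "s \<in> {0..t}" for s
    using seminorm_diff[OF sp, of x "T s x"] C(2)[OF that, of x] by (simp add: B_def)
  have B0: "0 \<le> B"
    using B[of 0] t seminorm_nonneg[OF sp, of "x - T 0 x"] by simp
  obtain d where d: "0 < d"
    "\<And>r s. r \<in> {0..t} \<Longrightarrow> s \<in> {0..t} \<Longrightarrow> \<bar>r - s\<bar> < d \<Longrightarrow> p (T r x - T s x) < e"
    using orbit_uniformly_continuous[OF p _ e, of t x] t by auto
  define d' where "d' = min d (t / 2)"
  have d': "0 < d'" "d' \<le> d" "d' \<le> t / 2"
    using d t by (auto simp: d'_def)
  \<comment> \<open>the minimum of \<open>1 - cos (2 \<pi> s / t)\<close> over \<open>d' \<le> s \<le> t - d'\<close>\<close>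
  define c where "c = 1 - cos (2 * pi * d' / t)"
  have angle: "0 < 2 * pi * d' / t" "2 * pi * d' / t \<le> pi"
    using d' t by (simp_all add: field_simps)
  have c: "0 < c"
    using cos_monotone_0_pi[of 0 "2 * pi * d' / t"] angle by (simp add: c_def)
  show thesis
  proof (rule that)
    fix s assume s: "s \<in> {0..t}"
    have cos_le: "0 \<le> B / c * (1 - cos (2 * pi * s / t))"
      using B0 c by simp
    consider "s < d'" | "t - s < d'" | "d' \<le> s" "s \<le> t / 2" | "t / 2 \<le> s" "d' \<le> t - s"
      by linarith
    then show "p (x - T s x) \<le> e + B / c * (1 - cos (2 * pi * s / t))"
    proof cases
      case 1
      then have "p (x - T s x) < e"
        using d(2)[of 0 s] s t d' by simp
      then show ?thesis using cos_le by simp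
    next
      case 2
      then have "p (x - T s x) < e"
        using d(2)[of t s] s t d' x by simp
      then show ?thesis using cos_le by simp
    next
      case 3
      have "2 * pi * d' / t \<le> 2 * pi * s / t" "2 * pi * s / t \<le> pi"
        using 3 t by (simp_all add: field_simps)
      then have "cos (2 * pi * s / t) \<le> cos (2 * pi * d' / t)"
        using angle by (intro cos_monotone_0_pi_le) auto
      then have "B / c * c \<le> B / c * (1 - cos (2 * pi * s / t))"
        using B0 c by (intro mult_left_mono) (auto simp: c_def)
      then show ?thesis using B[OF s] e c by simp
    next
      case 4
      have "2 * pi * d' / t \<le> 2 * pi * (t - s) / t"
        using 4 t by (intro divide_right_mono mult_left_mono) auto
      moreover have "2 * pi * (t - s) / t \<le> pi"
        using 4 t by (simp add: field_simps)
      ultimately have "cos (2 * pi * (t - s) / t) \<le> cos (2 * pi * d' / t)"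
        using angle by (intro cos_monotone_0_pi_le) auto
      moreover have "2 * pi * (t - s) / t = 2 * pi - 2 * pi * s / t"
        using t by (simp add: field_simps)
      ultimately have "cos (2 * pi * s / t) \<le> cos (2 * pi * d' / t)"
        by simp
      then have "B / c * c \<le> B / c * (1 - cos (2 * pi * s / t))"
        using B0 c by (intro mult_left_mono) (auto simp: c_def)
      then show ?thesis using B[OF s] e c by simp
    qed
  qed
qed

text \<open>Riemann sums for the \<open>k\<close>-th Fourier coefficient of the orbit of \<open>x\<close> as a function of period \<open>t\<close>. Writing
  them as means of a rescaled semigroup makes the convergence and invariance of means applicable.\<close>

definition fourier_mean :: "real \<Rightarrow> 'a \<Rightarrow> int \<Rightarrow> nat \<Rightarrow> 'a" where
  "fourier_mean t x k = orbit_mean smul (rescale smul (2 * pi * of_int k * \<i> / t) T) t x"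

lemma fourier_mean_eq:
  assumes "0 < t"
  shows "fourier_mean t x k N
    = smul (1 / of_nat N) (\<Sum>j<N. smul (cis (of_int (- k) * (2 * pi * real j / real N))) (T (j * t / N) x))"
proof -
  have "exp (- (of_real (j * t / N) * (2 * pi * of_int k * \<i> / t)))
      = cis (of_int (- k) * (2 * pi * real j / real N))" for j :: nat
    using assms by (simp add: cis_conv_exp field_simps)
  then show ?thesis
    by (simp add: fourier_mean_def orbit_mean_def rescale_def)
qed

text \<open>The mean of the orbit against the Fejer kernel is a combination of Fourier means, with a number of
  terms that does not depend on \<open>N\<close>.\<close>

lemma fejer_mean_fourier:
  assumes "0 < t"
  shows "smul (1 / of_nat N) (\<Sum>j<N. smul (of_real (fejer n (2 * pi * real j / real N))) (T (j * t / N) x))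
    = smul (1 / of_nat n) (\<Sum>a<n. \<Sum>b<n. fourier_mean t x (int b - int a) N)"
proof -
  let ?c = "\<lambda>a b j. cis (of_int (int a - int b) * (2 * pi * real j / real N))"
  have "(\<Sum>j<N. smul (of_real (fejer n (2 * pi * real j / real N))) (T (j * t / N) x))
      = (\<Sum>j<N. smul (1 / of_nat n) (\<Sum>a<n. \<Sum>b<n. smul (?c a b j) (T (j * t / N) x)))"
    by (simp add: fejer_expand flip: scale_sum_left)
  also have "\<dots> = smul (1 / of_nat n) (\<Sum>j<N. \<Sum>a<n. \<Sum>b<n. smul (?c a b j) (T (j * t / N) x))"
    by (simp only: scale_sum_right)
  also have "(\<Sum>j<N. \<Sum>a<n. \<Sum>b<n. smul (?c a b j) (T (j * t / N) x))
      = (\<Sum>a<n. \<Sum>b<n. \<Sum>j<N. smul (?c a b j) (T (j * t / N) x))"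
    by (subst sum.swap, rule sum.cong[OF refl], rule sum.swap)
  finally show ?thesis
    by (simp add: fourier_mean_eq[OF assms] scale_left_commute flip: scale_sum_right)
qed

text \<open>Uniqueness of Fourier coefficients. Write \<open>x\<close> as its mean against the Fejer kernel, which has mean
  \<open>1\<close>, and split \<open>x = (x - T s x) + T s x\<close>. The first part contributes at most \<open>e + M/n\<close>, and the
  second is a combination of Fourier means, which disappears as \<open>N \<rightarrow> \<infinity>\<close> for fixed \<open>n\<close>.\<close>

lemma fourier_means_separate:
  assumes p: "p \<in> \<Gamma>" and t: "0 < t" and x: "T t x = x"
    and means: "\<And>k. (\<lambda>N. p (fourier_mean t x k N)) \<longlonglongrightarrow> 0"
  shows "p x = 0"
proof -
  note sp = seminorms[OF p]
  have "p x \<le> e" if e: "0 < e" for e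
  proof -
    obtain M where M: "\<And>s. s \<in> {0..t} \<Longrightarrow> p (x - T s x) \<le> e + M * (1 - cos (2 * pi * s / t))"
      using periodic_orbit_displacement_le[OF p t x e] by auto
    have "p x \<le> e + M / n" if n: "0 < n" for n :: nat
    proof -
      have bound: "p x \<le> e + M / n
          + cmod (1 / of_nat n) * (\<Sum>a<n. \<Sum>b<n. p (fourier_mean t x (int b - int a) N))"
        if N: "n < N" for N
      proof -
        let ?\<theta> = "\<lambda>j. 2 * pi * real j / real N"
        let ?y = "smul (1 / of_nat N) (\<Sum>j<N. smul (of_real (fejer n (?\<theta> j))) (T (j * t / N) x))"
        let ?z = "smul (1 / of_nat N) (\<Sum>j<N. smul (of_real (fejer n (?\<theta> j))) (x - T (j * t / N) x))"
        have "(\<Sum>j<N. smul (of_real (fejer n (?\<theta> j))) x) = smul (of_nat N) x"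
          using fejer_mean[of n N] n N
          by (simp flip: scale_sum_left of_real_sum)
        then have split: "x = ?z + ?y"
          using n N by (simp add: scale_right_diff_distrib sum_subtractf)
        have "p (\<Sum>j<N. smul (of_real (fejer n (?\<theta> j))) (x - T (j * t / N) x))
            \<le> (\<Sum>j<N. p (smul (of_real (fejer n (?\<theta> j))) (x - T (j * t / N) x)))"
          by (rule seminorm_sum[OF sp])
        also have "\<dots> = (\<Sum>j<N. fejer n (?\<theta> j) * p (x - T (j * t / N) x))"
          by (simp add: seminorm_scale[OF sp] fejer_nonneg)
        also have "\<dots> \<le> (\<Sum>j<N. fejer n (?\<theta> j) * (e + M * (1 - cos (?\<theta> j))))"
        proof (intro sum_mono mult_left_mono fejer_nonneg)
          fix j assume j: "j \<in> {..<N}"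
          then have "j * t / N \<in> {0..t}" using t by (simp add: field_simps)
          moreover have "2 * pi * (j * t / N) / t = ?\<theta> j" using t by simp
          ultimately show "p (x - T (j * t / N) x) \<le> e + M * (1 - cos (?\<theta> j))"
            using M[of "j * t / N"] by simp
        qed
        also have "\<dots> = e * (\<Sum>j<N. fejer n (?\<theta> j))
            + M * (\<Sum>j<N. fejer n (?\<theta> j) * (1 - cos (?\<theta> j)))"
          by (simp add: sum_distrib_left flip: sum.distrib) (simp add: algebra_simps)
        also have "\<dots> = N * (e + M / n)"
          unfolding fejer_mean[OF n less_imp_le[OF N]] fejer_mean_cos[OF n N]
          by (simp add: algebra_simps)
        finally have z: "p ?z \<le> e + M / n"
          using N by (simp add: seminorm_scale[OF sp] norm_divide field_simps)
        have "p ?y \<le> cmod (1 / of_nat n) * (\<Sum>a<n. \<Sum>b<n. p (fourier_mean t x (int b - int a) N))"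
          unfolding fejer_mean_fourier[OF t] seminorm_scale[OF sp]
          by (intro mult_left_mono order_trans[OF seminorm_sum[OF sp]] sum_mono seminorm_sum[OF sp]) auto
        moreover have "p x = p (?z + ?y)"
          by (rule arg_cong[OF split])
        ultimately show ?thesis
          using z seminorm_triangle[OF sp, of ?z ?y] by linarith
      qed
      have "(\<lambda>N. e + M / n
          + cmod (1 / of_nat n) * (\<Sum>a<n. \<Sum>b<n. p (fourier_mean t x (int b - int a) N)))
          \<longlonglongrightarrow> e + M / n + cmod (1 / of_nat n) * (\<Sum>a<n. \<Sum>b<n. 0)"
        by (intro tendsto_intros means)
      then have "p x \<le> e + M / n + cmod (1 / of_nat n) * (\<Sum>a<n. \<Sum>b<n. 0)"
        by (rule tendsto_lowerbound)
          (use bound in \<open>auto intro: eventually_mono[OF eventually_gt_at_top[of n]]\<close>)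
      then show ?thesis by simp
    qed
    moreover have "(\<lambda>n::nat. e + M / n) \<longlonglongrightarrow> e + 0"
      by (intro tendsto_intros lim_const_over_n)
    ultimately have "p x \<le> e + 0"
      by (intro tendsto_lowerbound[where F = sequentially])
        (auto intro: eventually_mono[OF eventually_gt_at_top[of 0]])
    then show ?thesis by simp
  qed
  then show ?thesis
    using seminorm_nonneg[OF sp, of x] field_le_epsilon[of "p x" 0] by simp
qed

end

section \<open>Eigenvectors of the semigroup and of its derivative at zero\<close>

lemma exp_difference_quotient:
  "((\<lambda>h. (exp (of_real h * c) - 1) / of_real h) \<longlongrightarrow> (c::complex)) (at_right (0::real))"
proof -
  have "((\<lambda>z. exp (z * c)) has_field_derivative c) (at 0)"
    by (auto intro!: derivative_eq_intros)
  then have "((\<lambda>h. (exp (h * c) - 1) / h) \<longlongrightarrow> c) (at 0)"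
    by (simp add: DERIV_def)
  moreover have "filterlim complex_of_real (at 0) (at_right 0)"
  proof (rule filterlim_atI)
    show "(complex_of_real \<longlongrightarrow> 0) (at_right 0)"
      using tendsto_of_real[OF tendsto_ident_at, of 0 "{0<..}"] by simp
    show "eventually (\<lambda>h. complex_of_real h \<noteq> 0) (at_right 0)"
      by (auto simp: eventually_at_right_field intro: exI[of _ 1])
  qed
  ultimately show ?thesis
    by (rule filterlim_compose)
qed

context seminormed_semigroup
begin

text \<open>By the product rule the orbit of \<open>z\<close> under the semigroup rescaled by \<open>c\<close> has derivative
  \<open>c z - c z = 0\<close> at \<open>0\<close>.\<close>

lemma derivative_eigenvector:
  assumes z: "\<And>q. q \<in> \<Gamma> \<Longrightarrow>
      ((\<lambda>h. q (smul (of_real (1 / h)) (T h z - z) - smul c z)) \<longlongrightarrow> 0) (at_right 0)"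
    and p: "p \<in> \<Gamma>" and t: "0 < t"
  shows "p (rescale smul c T t z - z) = 0"
proof -
  interpret S: seminormed_semigroup smul \<Gamma> "rescale smul c T"
    by (rule seminormed_semigroup_rescale)
  show ?thesis
  proof (rule S.invariant_if_derivative_zero[OF _ p t])
    fix q assume q: "q \<in> \<Gamma>"
    note sq = seminorms[OF q]
    let ?a = "\<lambda>h. exp (of_real h * (- c))"
    let ?D = "\<lambda>h. smul (of_real (1 / h)) (T h z - z) - smul c z"
    let ?b = "\<lambda>h. (?a h - 1) / of_real h + c * ?a h"
    show "((\<lambda>h. q (rescale smul c T h z - z) / h) \<longlongrightarrow> 0) (at_right 0)"
    proof (rule tendsto_sandwich)
      show "\<forall>\<^sub>F h in at_right 0. 0 \<le> q (rescale smul c T h z - z) / h"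
        using seminorm_nonneg[OF sq] by (auto simp: eventually_at_right_field intro: exI[of _ 1])
      have "q (rescale smul c T h z - z) / h \<le> cmod (?a h) * q (?D h) + cmod (?b h) * q z"
        if h: "0 < h" for h
      proof -
        have "smul (of_real (1 / h)) (rescale smul c T h z - z) = smul (?a h) (?D h) + smul (?b h) z"
          by (simp add: rescale_def scale_right_diff_distrib scale_left_diff_distrib
              scale_left_distrib diff_divide_distrib mult.commute)
        moreover have "q (rescale smul c T h z - z) / h
            = q (smul (of_real (1 / h)) (rescale smul c T h z - z))"
          using h by (simp add: seminorm_scale[OF sq] norm_divide)
        ultimately show ?thesis
          by (metis seminorm_triangle[OF sq] seminorm_scale[OF sq])
      qed
      then show "\<forall>\<^sub>F h in at_right 0. q (rescale smul c T h z - z) / h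
          \<le> cmod (?a h) * q (?D h) + cmod (?b h) * q z"
        by (auto simp: eventually_at_right_field intro: exI[of _ 1])
      have "((\<lambda>h. cmod (?a h) * q (?D h) + cmod (?b h) * q z) \<longlongrightarrow>
          cmod (exp (of_real 0 * (- c))) * 0 + cmod (- c + c * exp (of_real 0 * (- c))) * q z) (at_right 0)"
        by (intro tendsto_intros z q exp_difference_quotient)
      then show "((\<lambda>h. cmod (?a h) * q (?D h) + cmod (?b h) * q z) \<longlongrightarrow> 0) (at_right 0)"
        by simp
    qed simp
  qed
qed

lemma eigenvector_derivative:
  assumes y: "\<And>h. 0 \<le> h \<Longrightarrow> T h y = smul (exp (of_real h * c)) y" and q: "q \<in> \<Gamma>"
  shows "((\<lambda>h. q (smul (of_real (1 / h)) (T h y - y) - smul c y)) \<longlongrightarrow> 0) (at_right 0)"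
proof -
  note sq = seminorms[OF q]
  have "((\<lambda>h. cmod ((exp (of_real h * c) - 1) / of_real h - c) * q y) \<longlongrightarrow> cmod (c - c) * q y) (at_right 0)"
    by (intro tendsto_intros exp_difference_quotient)
  moreover have "cmod ((exp (of_real h * c) - 1) / of_real h - c) * q y
      = q (smul (of_real (1 / h)) (T h y - y) - smul c y)" if h: "0 < h" for h
  proof -
    have "smul (of_real (1 / h)) (T h y - y) - smul c y
        = smul ((exp (of_real h * c) - 1) / of_real h - c) y"
      using h by (simp add: y scale_right_diff_distrib scale_left_diff_distrib diff_divide_distrib)
    then show ?thesis by (simp only: seminorm_scale[OF sq])
  qed
  then have "\<forall>\<^sub>F h in at_right 0. cmod ((exp (of_real h * c) - 1) / of_real h - c) * q y
      = q (smul (of_real (1 / h)) (T h y - y) - smul c y)"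
    by (auto simp: eventually_at_right_field intro: exI[of _ 1])
  ultimately show ?thesis
    by (simp add: filterlim_cong[OF refl refl])
qed

end

section \<open>Locally convex topologies through their seminorms\<close>

lemma atin_within_euclidean: "atin_within euclidean a S = at a within S"
  by (rule filter_eqI) (auto simp: eventually_atin_within eventually_at_topological)

context locally_convex_space
begin

sublocale complex_vector_space smul ..

lemma seminorms_nonempty: "\<Gamma> \<noteq> {}"
proof -
  have "seminorm smul (\<lambda>_. 0)" by (simp add: seminorm_def)
  then show ?thesis using fundamental[of "\<lambda>_. 0"] by auto
qed

lemma openin_seminorm_ball: "p \<in> \<Gamma> \<Longrightarrow> 0 < e \<Longrightarrow> openin X {y. p (y - x) < e}"
  unfolding topology_eq seminorm_topology_def by (rule topology_generated_by_Basis) auto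

lemma topspace_UNIV: "topspace X = UNIV"
proof -
  obtain p where p: "p \<in> \<Gamma>" using seminorms_nonempty by auto
  have "x \<in> topspace X" for x
    using openin_subset[OF openin_seminorm_ball[OF p, of 1 x]] seminorm_zero[OF seminorms[OF p]]
    by auto
  then show ?thesis by auto
qed

text \<open>The balls are only a subbase of the topology, hence the finite set of seminorms. Balls around other
  centres are absorbed by shrinking the radius.\<close>

lemma openin_contains_seminorm_balls:
  assumes "openin X U" "x \<in> U"
  shows "\<exists>F e. finite F \<and> F \<subseteq> \<Gamma> \<and> 0 < e \<and> {y. \<forall>p\<in>F. p (y - x) < e} \<subseteq> U"
proof -
  have "generate_topology_on {{y. p (y - x) < e} | p x e. p \<in> \<Gamma> \<and> e > 0} U"
    using assms(1) unfolding topology_eq seminorm_topology_def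
    by (rule openin_topology_generated_by)
  then show ?thesis
    using assms(2)
  proof induction
    case Empty
    then show ?case by simp
  next
    case (Int U V)
    then obtain F d G e where
      "finite F" "F \<subseteq> \<Gamma>" "0 < d" "{y. \<forall>p\<in>F. p (y - x) < d} \<subseteq> U"
      "finite G" "G \<subseteq> \<Gamma>" "0 < e" "{y. \<forall>p\<in>G. p (y - x) < e} \<subseteq> V"
      by auto
    then show ?case
      by (intro exI[of _ "F \<union> G"] exI[of _ "min d e"]) auto
  next
    case (UN K)
    then obtain V where "V \<in> K" "x \<in> V" by auto
    then show ?case using UN.IH[of V] by blast
  next
    case (Basis U)
    then obtain p z e where p: "p \<in> \<Gamma>" and U: "U = {y. p (y - z) < e}" by auto
    have "{y. \<forall>q\<in>{p}. q (y - x) < e - p (x - z)} \<subseteq> U"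
      by (auto simp: U intro: le_less_trans[OF seminorm_diff_triangle[OF seminorms[OF p], of _ z x]])
    moreover have "0 < e - p (x - z)" using Basis U by simp
    ultimately show ?case
      using p by (intro exI[of _ "{p}"] exI[of _ "e - p (x - z)"]) auto
  qed
qed

lemma limitin_iff_seminorms:
  "limitin X f l F \<longleftrightarrow> (\<forall>p\<in>\<Gamma>. ((\<lambda>i. p (f i - l)) \<longlongrightarrow> 0) F)"
proof (intro iffI ballI)
  fix p assume lim: "limitin X f l F" and p: "p \<in> \<Gamma>"
  note sp = seminorms[OF p]
  show "((\<lambda>i. p (f i - l)) \<longlongrightarrow> 0) F"
  proof (rule tendstoI)
    fix e :: real assume "0 < e"
    then have "\<forall>\<^sub>F i in F. f i \<in> {y. p (y - l) < e}"
      using limitinD[OF lim openin_seminorm_ball[OF p, of e l]] seminorm_zero[OF sp] by simp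
    then show "\<forall>\<^sub>F i in F. dist (p (f i - l)) 0 < e"
      by (simp add: seminorm_nonneg[OF sp])
  qed
next
  assume lim: "\<forall>p\<in>\<Gamma>. ((\<lambda>i. p (f i - l)) \<longlongrightarrow> 0) F"
  show "limitin X f l F"
    unfolding limitin_def
  proof (intro conjI allI impI)
    show "l \<in> topspace X" by (simp add: topspace_UNIV)
    fix U assume "openin X U \<and> l \<in> U"
    then obtain P e where P: "finite P" "P \<subseteq> \<Gamma>" "0 < e" "{y. \<forall>p\<in>P. p (y - l) < e} \<subseteq> U"
      using openin_contains_seminorm_balls[of U l] by auto
    have "\<forall>\<^sub>F i in F. \<forall>p\<in>P. p (f i - l) < e"
    proof (intro eventually_ball_finite ballI)
      show "finite P" by fact
      fix p assume "p \<in> P"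
      then have "((\<lambda>i. p (f i - l)) \<longlongrightarrow> 0) F" using lim P(2) by blast
      then show "\<forall>\<^sub>F i in F. p (f i - l) < e" using \<open>0 < e\<close> by (rule order_tendstoD(2))
    qed
    then show "\<forall>\<^sub>F i in F. f i \<in> U"
      by (rule eventually_mono) (use P(4) in blast)
  qed
qed

lemma Cauchy_sequence_if_seminorms:
  assumes "\<And>p e. p \<in> \<Gamma> \<Longrightarrow> 0 < e \<Longrightarrow> \<exists>N. \<forall>m\<ge>N. \<forall>n\<ge>N. p (s m - s n) < e"
  shows "Cauchy_sequence X s"
  unfolding Cauchy_sequence_def
proof (intro allI impI)
  fix U assume "openin X U \<and> 0 \<in> U"
  then obtain P e where P: "finite P" "P \<subseteq> \<Gamma>" "0 < e" "{y. \<forall>p\<in>P. p (y - 0) < e} \<subseteq> U"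
    using openin_contains_seminorm_balls[of U 0] by auto
  have "\<forall>p\<in>P. \<exists>N. \<forall>m\<ge>N. \<forall>n\<ge>N. p (s m - s n) < e"
    using P assms by blast
  then obtain N where N: "\<And>p m n. p \<in> P \<Longrightarrow> N p \<le> m \<Longrightarrow> N p \<le> n \<Longrightarrow> p (s m - s n) < e"
    by metis
  have "s m - s n \<in> U" if "(\<Sum>p\<in>P. N p) \<le> m" "(\<Sum>p\<in>P. N p) \<le> n" for m n
  proof -
    have "p (s m - s n) < e" if "p \<in> P" for p
      using N[OF that] member_le_sum[OF that, of N] P(1) \<open>_ \<le> m\<close> \<open>_ \<le> n\<close>
      by (meson le0 order_trans)
    then show ?thesis using P(4) by auto
  qed
  then show "\<exists>N. \<forall>m\<ge>N. \<forall>n\<ge>N. s m - s n \<in> U" by blast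
qed

text \<open>A constant sequence at a point on which all seminorms vanish converges both to that point and to
  \<open>0\<close>.\<close>

lemma Hausdorff_seminorms_separate:
  assumes "Hausdorff_space X" "\<And>p. p \<in> \<Gamma> \<Longrightarrow> p x = 0"
  shows "x = 0"
proof -
  have "limitin X (\<lambda>_. x) 0 sequentially" "limitin X (\<lambda>_. x) x sequentially"
    unfolding limitin_iff_seminorms
    by (auto simp: assms(2) seminorm_zero seminorms intro: tendsto_eq_rhs[OF tendsto_const])
  then show ?thesis
    by (rule limitin_Hausdorff_unique[OF _ _ trivial_limit_sequentially assms(1), symmetric])
qed

lemma seminormed_semigroup_if_strongly_continuous:
  assumes semigroup: "operator_semigroup smul X T"
    and cont: "strongly_continuous X T"
    and equi: "locally_equicontinuous \<Gamma> T"
  shows "seminormed_semigroup smul \<Gamma> T"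
proof (intro seminormed_semigroup.intro seminormed_semigroup_axioms.intro)
  show "complex_vector_space smul" by unfold_locales
  show "T 0 x = x" for x using semigroup by (simp add: operator_semigroup_def)
  show "Vector_Spaces.linear smul smul (T s)" if "0 \<le> s" for s
    using semigroup that by (simp add: operator_semigroup_def continuous_linear_operator_def)
  show "T (r + s) x = T r (T s x)" if "0 \<le> r" "0 \<le> s" for r s x
    using semigroup that by (simp add: operator_semigroup_def)
  fix p assume p: "p \<in> \<Gamma>"
  then show "seminorm smul p" by (rule seminorms)
  show "\<exists>q\<in>\<Gamma>. \<exists>C\<ge>0. \<forall>s\<in>{0..b}. \<forall>x. p (T s x) \<le> C * q x" if "0 \<le> b" for b
    using equi p that unfolding locally_equicontinuous_def by blast
  show "((\<lambda>s. p (T s x - x)) \<longlongrightarrow> 0) (at_right 0)" for x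
  proof -
    have "continuous_map (top_of_set {0..}) X (\<lambda>s. T s x)"
      using cont by (simp add: strongly_continuous_def)
    then have "limitin X (\<lambda>s. T s x) (T 0 x) (atin (top_of_set {0..}) 0)"
      by (simp add: continuous_map_atin)
    then have "limitin X (\<lambda>s. T s x) x (at 0 within {0..})"
      using semigroup
      by (simp add: atin_subtopology_within atin_within_euclidean operator_semigroup_def)
    then have "((\<lambda>s. p (T s x - x)) \<longlongrightarrow> 0) (at 0 within {0..})"
      using p by (simp add: limitin_iff_seminorms)
    then show ?thesis by (rule tendsto_within_subset) auto
  qed
qed

end

section \<open>The spectral mapping theorem for the point spectrum\<close>

lemma (in complex_vector_space) point_spectrum_linear_iff:
  assumes "Vector_Spaces.linear smul smul f"
  shows "c \<in> point_spectrum smul f UNIV \<longleftrightarrow> (\<exists>x. x \<noteq> 0 \<and> f x = smul c x)"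
proof
  assume "c \<in> point_spectrum smul f UNIV"
  then obtain x y where xy: "x \<noteq> y" "smul c x - f x = smul c y - f y"
    by (auto simp: point_spectrum_def inj_on_def)
  have "f (x - y) = f x - f y"
    using assms by (simp add: module_hom.diff flip: module_hom_iff_linear)
  also have "\<dots> = smul c (x - y)"
    using xy(2) by (simp add: scale_right_diff_distrib algebra_simps)
  finally show "\<exists>x. x \<noteq> 0 \<and> f x = smul c x"
    using xy(1) by (intro exI[of _ "x - y"]) simp
next
  assume "\<exists>x. x \<noteq> 0 \<and> f x = smul c x"
  then obtain x where "x \<noteq> 0" "f x = smul c x" by auto
  moreover have "f 0 = 0"
    using assms by (simp add: module_hom.zero flip: module_hom_iff_linear)
  ultimately have "smul c x - f x = smul c 0 - f 0" "x \<noteq> 0" by simp_all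
  then show "c \<in> point_spectrum smul f UNIV"
    unfolding point_spectrum_def inj_on_def by blast
qed

text \<open>The topology and the seminorm estimates are combined here. By the Hausdorff property, what the
  estimates yield for every seminorm become equations between vectors, and the values of the generator
  are unique.\<close>

locale Hausdorff_semigroup = locally_convex_space smul X \<Gamma> + seminormed_semigroup smul \<Gamma> T
  for smul :: "complex \<Rightarrow> 'a::ab_group_add \<Rightarrow> 'a" and X \<Gamma> T +
  assumes Hausdorff: "Hausdorff_space X"
begin

lemma has_generator_value_iff:
  "has_generator_value smul X T x y \<longleftrightarrow>
    (\<forall>p\<in>\<Gamma>. ((\<lambda>h. p (smul (of_real (1 / h)) (T h x - x) - y)) \<longlongrightarrow> 0) (at_right 0))"
  by (simp add: has_generator_value_def limitin_iff_seminorms)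

lemma generator_eqI:
  assumes "has_generator_value smul X T x y"
  shows "generator smul X T x = y"
  unfolding generator_def using assms
proof (rule the_equality)
  fix y' assume "has_generator_value smul X T x y'"
  then show "y' = y"
    using assms limitin_Hausdorff_unique[OF _ _ _ Hausdorff] trivial_limit_at_right_real
    unfolding has_generator_value_def by blast
qed

lemma has_generator_value_diff:
  assumes "has_generator_value smul X T x y" "has_generator_value smul X T x' y'"
  shows "has_generator_value smul X T (x - x') (y - y')"
  unfolding has_generator_value_iff
proof
  fix p assume p: "p \<in> \<Gamma>"
  note sp = seminorms[OF p]
  let ?f = "\<lambda>x y h. smul (of_real (1 / h)) (T h x - x) - y"
  show "((\<lambda>h. p (?f (x - x') (y - y') h)) \<longlongrightarrow> 0) (at_right 0)"
  proof (rule tendsto_sandwich)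
    show "\<forall>\<^sub>F h in at_right 0. 0 \<le> p (?f (x - x') (y - y') h)"
      by (simp add: seminorm_nonneg[OF sp])
    have "p (?f (x - x') (y - y') h) \<le> p (?f x y h) + p (?f x' y' h)" if "0 < h" for h
    proof -
      have "?f (x - x') (y - y') h = ?f x y h - ?f x' y' h"
        using that by (simp add: op_diff scale_right_diff_distrib algebra_simps)
      then show ?thesis by (simp only: seminorm_diff[OF sp])
    qed
    then show "\<forall>\<^sub>F h in at_right 0. p (?f (x - x') (y - y') h) \<le> p (?f x y h) + p (?f x' y' h)"
      by (auto simp: eventually_at_right_field intro: exI[of _ 1])
    have "((\<lambda>h. p (?f x y h) + p (?f x' y' h)) \<longlongrightarrow> 0 + 0) (at_right 0)"
      using assms p unfolding has_generator_value_iff by (intro tendsto_add) auto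
    then show "((\<lambda>h. p (?f x y h) + p (?f x' y' h)) \<longlongrightarrow> 0) (at_right 0)" by simp
  qed simp
qed

text \<open>The failure of injectivity gives two vectors; their difference is an eigenvector since the generator
  is linear.\<close>

lemma point_spectrum_generator_iff:
  "c \<in> point_spectrum smul (generator smul X T) (generator_domain smul X T) \<longleftrightarrow>
    (\<exists>z. z \<noteq> 0 \<and> has_generator_value smul X T z (smul c z))"
proof
  assume "c \<in> point_spectrum smul (generator smul X T) (generator_domain smul X T)"
  then obtain x x' y y' where x: "x \<noteq> x'"
    "has_generator_value smul X T x y" "has_generator_value smul X T x' y'"
    "smul c x - generator smul X T x = smul c x' - generator smul X T x'"
    by (auto simp: point_spectrum_def inj_on_def generator_domain_def)
  then have "y - y' = smul c (x - x')"
    by (simp add: generator_eqI scale_right_diff_distrib algebra_simps)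
  then show "\<exists>z. z \<noteq> 0 \<and> has_generator_value smul X T z (smul c z)"
    using has_generator_value_diff[OF x(2,3)] x(1) by (intro exI[of _ "x - x'"]) simp
next
  assume "\<exists>z. z \<noteq> 0 \<and> has_generator_value smul X T z (smul c z)"
  then obtain z where z: "z \<noteq> 0" "has_generator_value smul X T z (smul c z)" by auto
  have zero: "has_generator_value smul X T 0 0"
    using has_generator_value_diff[OF z(2) z(2)] by simp
  have "smul c z - generator smul X T z = smul c 0 - generator smul X T 0"
    by (simp add: generator_eqI[OF z(2)] generator_eqI[OF zero])
  moreover have "z \<in> generator_domain smul X T" "0 \<in> generator_domain smul X T"
    using z zero by (auto simp: generator_domain_def)
  ultimately show "c \<in> point_spectrum smul (generator smul X T) (generator_domain smul X T)"
    using z(1) unfolding point_spectrum_def inj_on_def by blast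
qed

lemma semigroup_eigenvector:
  assumes z: "has_generator_value smul X T z (smul c z)" and t: "0 < t"
  shows "T t z = smul (exp (of_real t * c)) z"
proof -
  have "p (rescale smul c T t z - z) = 0" if "p \<in> \<Gamma>" for p
    using derivative_eigenvector[OF _ that t] z by (simp add: has_generator_value_iff)
  then have "rescale smul c T t z = z"
    using Hausdorff_seminorms_separate[OF Hausdorff, of "rescale smul c T t z - z"] by simp
  then have "smul (exp (of_real t * c)) z = smul (exp (of_real t * c)) (rescale smul c T t z)"
    by simp
  also have "\<dots> = T t z"
    by (simp add: rescale_def mult_exp_exp)
  finally show ?thesis by simp
qed

text \<open>The eigenvector is a nonzero Fourier coefficient of the periodic orbit, and \<open>b\<close> below moves the
  eigenvalue \<open>w\<close> of \<open>T t\<close> to \<open>1\<close>. Any logarithm of \<open>w\<close> would do for this, as the others are reached by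
  the frequencies \<open>k\<close>.\<close>

lemma generator_eigenvector:
  assumes complete: "sequentially_complete X"
    and t: "0 < t" and x: "x \<noteq> 0" "T t x = smul w x" and w: "w \<noteq> 0"
  obtains c z where "exp (of_real t * c) = w" "z \<noteq> 0" "has_generator_value smul X T z (smul c z)"
proof -
  define b where "b = Ln w / t"
  have b: "exp (of_real t * b) = w"
    using t w by (simp add: b_def)
  interpret S: seminormed_semigroup smul \<Gamma> "rescale smul b T"
    by (rule seminormed_semigroup_rescale)
  have Sx: "rescale smul b T t x = x"
    using x w b by (simp add: rescale_def exp_minus)
  have "\<exists>k. \<exists>p\<in>\<Gamma>. \<not> (\<lambda>N. p (S.fourier_mean t x k N)) \<longlonglongrightarrow> 0"
  proof (rule ccontr)
    assume "\<not> ?thesis"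
    then have "p x = 0" if "p \<in> \<Gamma>" for p
      using S.fourier_means_separate[OF that t Sx] that by blast
    then show False
      using Hausdorff_seminorms_separate[OF Hausdorff] x by blast
  qed
  then obtain k p where p: "p \<in> \<Gamma>" "\<not> (\<lambda>N. p (S.fourier_mean t x k N)) \<longlonglongrightarrow> 0" by blast
  define d where "d = 2 * pi * of_int k * \<i> / t"
  have d: "exp (of_real t * d) = 1"
    using t by (simp add: d_def exp_eq_1)
  interpret U: seminormed_semigroup smul \<Gamma> "rescale smul d (rescale smul b T)"
    by (rule S.seminormed_semigroup_rescale)
  have Ux: "rescale smul d (rescale smul b T) t x = x"
    using Sx d by (simp add: rescale_def[of _ d] exp_minus)
  let ?R = "S.fourier_mean t x k"
  have R: "?R = orbit_mean smul (rescale smul d (rescale smul b T)) t x"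
    by (simp add: S.fourier_mean_def d_def)
  have "Cauchy_sequence X ?R"
    unfolding R by (rule Cauchy_sequence_if_seminorms) (rule U.orbit_mean_Cauchy[OF _ t])
  then obtain z where "limitin X ?R z sequentially"
    using complete unfolding sequentially_complete_def by blast
  then have z: "(\<lambda>N. q (?R N - z)) \<longlonglongrightarrow> 0" if "q \<in> \<Gamma>" for q
    using that by (simp add: limitin_iff_seminorms)
  have "z \<noteq> 0" using z[OF p(1)] p(2) by auto
  have "T h z = smul (exp (of_real h * (b + d))) z" if h: "0 \<le> h" for h
  proof -
    have "q (rescale smul d (rescale smul b T) h z - z) = 0" if "q \<in> \<Gamma>" for q
      using U.orbit_mean_limit_invariant[OF t Ux h _ that] z unfolding R by blast
    then have "rescale smul d (rescale smul b T) h z = z"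
      using Hausdorff_seminorms_separate[OF Hausdorff,
          of "rescale smul d (rescale smul b T) h z - z"] by simp
    then have "smul (exp (of_real h * (b + d))) z
        = smul (exp (of_real h * (b + d))) (rescale smul d (rescale smul b T) h z)"
      by simp
    also have "\<dots> = T h z"
      by (simp add: rescale_def mult_exp_exp algebra_simps)
    finally show ?thesis by simp
  qed
  then have "has_generator_value smul X T z (smul (b + d) z)"
    using eigenvector_derivative[of z "b + d"] by (simp add: has_generator_value_iff)
  moreover have "exp (of_real t * (b + d)) = w"
    using b d by (simp add: distrib_left exp_add)
  ultimately show thesis using that \<open>z \<noteq> 0\<close> by blast
qed

end

theorem theorem5p4:
  fixes smul :: "complex \<Rightarrow> 'a::ab_group_add \<Rightarrow> 'a"
    and X :: "'a topology"
    and \<Gamma> :: "('a \<Rightarrow> real) set"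
    and T :: "real \<Rightarrow> 'a \<Rightarrow> 'a"
    and t :: real
  assumes "locally_convex_space smul X \<Gamma>"
    and "Hausdorff_space X"
    and "sequentially_complete X"
    and "operator_semigroup smul X T"
    and "strongly_continuous X T"
    and "locally_equicontinuous \<Gamma> T"
    and "t \<ge> 0"
    and "t = 0 \<Longrightarrow> \<exists>x::'a. x \<noteq> 0 \<Longrightarrow>
      point_spectrum smul (generator smul X T) (generator_domain smul X T) \<noteq> {}"
  shows "point_spectrum smul (T t) UNIV - {0} =
    exp_set t (point_spectrum smul (generator smul X T) (generator_domain smul X T))"
proof -
  let ?\<sigma> = "point_spectrum smul (generator smul X T) (generator_domain smul X T)"
  interpret locally_convex_space smul X \<Gamma> by fact
  interpret Hausdorff_semigroup smul X \<Gamma> T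
    using assms(1,2) seminormed_semigroup_if_strongly_continuous[OF assms(4-6)]
    by (simp add: Hausdorff_semigroup_def Hausdorff_semigroup_axioms_def)
  have T_iff: "w \<in> point_spectrum smul (T t) UNIV \<longleftrightarrow> (\<exists>x. x \<noteq> 0 \<and> T t x = smul w x)" for w
    by (rule point_spectrum_linear_iff[OF linear[OF \<open>t \<ge> 0\<close>]])
  show ?thesis
  proof (cases "t = 0")
    \<comment> \<open>The left side is \<open>{1}\<close> if there is a nonzero vector, the right side is \<open>{1}\<close> if the generator
      has an eigenvalue, and otherwise they are empty. An eigenvector is a nonzero vector; the last
      assumption gives the converse.\<close>
    case True
    have "w \<in> point_spectrum smul (T t) UNIV \<longleftrightarrow> w = 1 \<and> (\<exists>x::'a. x \<noteq> 0)" for w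
    proof -
      have "x = smul w x \<longleftrightarrow> w = 1" if "x \<noteq> 0" for x
        using that scale_cancel_right[of 1 x w] by auto
      then show ?thesis unfolding T_iff using True by auto
    qed
    moreover have "exp_set t ?\<sigma> = (if ?\<sigma> = {} then {} else {1})"
      using True by (auto simp: exp_set_def)
    moreover have "?\<sigma> \<noteq> {} \<longleftrightarrow> (\<exists>x::'a. x \<noteq> 0)"
    proof
      assume "?\<sigma> \<noteq> {}"
      then obtain c where "c \<in> ?\<sigma>" by auto
      then show "\<exists>x::'a. x \<noteq> 0" using point_spectrum_generator_iff by blast
    qed (rule assms(8)[OF True])
    ultimately show ?thesis by auto
  next
    case False
    then have t: "0 < t" using \<open>t \<ge> 0\<close> by simp
    show ?thesis
    proof (intro equalityI subsetI)
      fix w assume "w \<in> point_spectrum smul (T t) UNIV - {0}"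
      then obtain x where "x \<noteq> 0" "T t x = smul w x" "w \<noteq> 0"
        using T_iff by auto
      then obtain c z where "exp (of_real t * c) = w" "z \<noteq> 0"
          "has_generator_value smul X T z (smul c z)"
        using generator_eigenvector[OF assms(3) t] by blast
      then show "w \<in> exp_set t ?\<sigma>"
        unfolding exp_set_def using point_spectrum_generator_iff by blast
    next
      fix w assume "w \<in> exp_set t ?\<sigma>"
      then obtain c z where w: "w = exp (of_real t * c)"
        and z: "z \<noteq> 0" "has_generator_value smul X T z (smul c z)"
        unfolding exp_set_def using point_spectrum_generator_iff by blast
      then have "T t z = smul w z"
        using semigroup_eigenvector[OF z(2) t] by simp
      then show "w \<in> point_spectrum smul (T t) UNIV - {0}"
        using T_iff z(1) w by auto
    qed
  qed
qed

end
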